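(* Let $\mathsf{S}=(S,* )$ and $\mathsf{T}=(T,\cdot)$ be semigroups, with $\mathsf{T}$ non-degenerate. Let $f\colon \mathsf{S}\to |\mathsf{TrHull}(\mathsf{T})|$ be a homomorphism of semigroups which is translation non-degenerate. Then there is a unique homomorphism of monoids $f^\sharp\colon \mathsf{TrHull}(\mathsf{S})\to \mathsf{TrHull}(\mathsf{T})$ such that $|f^\sharp|\circ \mathfrak{M}_{\mathsf{S}}=f$. Moreover $|f^\sharp|\colon |\mathsf{TrHull}(\mathsf{S})|\to |\mathsf{TrHull}(\mathsf{T})|$ is also translation non-degenerate.
   Context: Semigroups here are ordinary (set-theoretic) semigroups, possibly empty; $|-|$ denotes the forgetful functor from monoids to semigroups. For a semigroup $\mathsf{S}=(S,* )$, a left translation is a map $L\colon S\to S$ with $L(x*y)=L(x)*y$, and a right translation is a map $R\colon S\to S$ with $R(x*y)=x*R(y)$, for all $x,y\in S$. A multiplier is a pair $(L,R)$ of a left and a right translation such that $R(x)*y=x*L(y)$ for all $x,y\in S$. The translational hull $\mathsf{TrHull}(\mathsf{S})$ is the monoid of all multipliers, with product $(L',R')\star(L,R)=(L'\circ L,R\circ R')$ and identity $(id_S,id_S)$. The canonical homomorphism $\mathfrak{M}_{\mathsf{S}}\colon \mathsf{S}\to|\mathsf{TrHull}(\mathsf{S})|$ is $x\mapsto(\mathfrak{L}_x,\mathfrak{R}_x)$ with $\mathfrak{L}_x(y)=x*y$, $\mathfrak{R}_x(y)=y*x$. A semigroup $(T,\cdot)$ is non-degenerate when both: ($x\cdot y=x\cdot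 z$ for all $x\in T$ implies $y=z$) and ($y\cdot x=z\cdot x$ for all $x\in T$ implies $y=z$). For a set $X$ and a map $f\colon X\to \mathsf{TrHull}(\mathsf{T})$, write $f(x)=(f_L(x),f_R(x))$. The map $f$ is translation non-degenerate when $T=\{f_L(x)(t)\colon x\in X,\ t\in T\}=\{f_R(x)(t)\colon x\in X,\ t\in T\}$. *)

theory Defs
  imports "HOL-Algebra.Group"
begin

record 'a sgrp = "'a partial_object" +
  sprod :: "'a \<Rightarrow> 'a \<Rightarrow> 'a" (infixl \<open>\<cdot>\<index>\<close> 70)

text \<open>The carrier may be empty.\<close>

locale sgrp =
  fixes S :: "'a sgrp" (structure)
  assumes sprod_closed [intro, simp]:
      "\<lbrakk>x \<in> carrier S; y \<in> carrier S\<rbrakk> \<Longrightarrow> x \<cdot> y \<in> carrier S"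
    and sprod_assoc:
      "\<lbrakk>x \<in> carrier S; y \<in> carrier S; z \<in> carrier S\<rbrakk> \<Longrightarrow> (x \<cdot> y) \<cdot> z = x \<cdot> (y \<cdot> z)"

text \<open>
  Maps between carriers are represented by extensional functions, so that equality of
  maps is equality in HOL; composition of maps is \<^const>\<open>compose\<close>.
  In particular, homomorphisms are extensional, unlike the elements of \<^const>\<open>hom\<close>.
\<close>

definition sgrp_hom :: "'a sgrp \<Rightarrow> 'b sgrp \<Rightarrow> ('a \<Rightarrow> 'b) set" where
  "sgrp_hom S T = {h \<in> carrier S \<rightarrow>\<^sub>E carrier T.
     \<forall>x\<in>carrier S. \<forall>y\<in>carrier S. h (x \<cdot>\<^bsub>S\<^esub> y) = h x \<cdot>\<^bsub>T\<^esub> h y}"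

definition monoid_hom :: "'a monoid \<Rightarrow> 'b monoid \<Rightarrow> ('a \<Rightarrow> 'b) set" where
  "monoid_hom M N = {h \<in> hom M N \<inter> extensional (carrier M). h \<one>\<^bsub>M\<^esub> = \<one>\<^bsub>N\<^esub>}"

text \<open>
  Object part of the forgetful functor from monoids to semigroups;
  on homomorphisms it leaves the underlying map unchanged, see \<open>monoid_hom_imp_sgrp_hom\<close>.
\<close>

definition forget :: "'a monoid \<Rightarrow> 'a sgrp" where
  "forget M = \<lparr>carrier = carrier M, sprod = mult M\<rparr>"

definition nondegenerate :: "'a sgrp \<Rightarrow> bool" where
  "nondegenerate T \<longleftrightarrow>
     (\<forall>y\<in>carrier T. \<forall>z\<in>carrier T. (\<forall>x\<in>carrier T. x \<cdot>\<^bsub>T\<^esub> y = x \<cdot>\<^bsub>T\<^esub> z) \<longrightarrow> y = z) \<and>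
     (\<forall>y\<in>carrier T. \<forall>z\<in>carrier T. (\<forall>x\<in>carrier T. y \<cdot>\<^bsub>T\<^esub> x = z \<cdot>\<^bsub>T\<^esub> x) \<longrightarrow> y = z)"

definition left_translations :: "'a sgrp \<Rightarrow> ('a \<Rightarrow> 'a) set" where
  "left_translations S = {L \<in> carrier S \<rightarrow>\<^sub>E carrier S.
     \<forall>x\<in>carrier S. \<forall>y\<in>carrier S. L (x \<cdot>\<^bsub>S\<^esub> y) = L x \<cdot>\<^bsub>S\<^esub> y}"

definition right_translations :: "'a sgrp \<Rightarrow> ('a \<Rightarrow> 'a) set" where
  "right_translations S = {R \<in> carrier S \<rightarrow>\<^sub>E carrier S.
     \<forall>x\<in>carrier S. \<forall>y\<in>carrier S. R (x \<cdot>\<^bsub>S\<^esub> y) = x \<cdot>\<^bsub>S\<^esub> R y}"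

definition multipliers :: "'a sgrp \<Rightarrow> (('a \<Rightarrow> 'a) \<times> ('a \<Rightarrow> 'a)) set" where
  "multipliers S = {(L, R). L \<in> left_translations S \<and> R \<in> right_translations S \<and>
     (\<forall>x\<in>carrier S. \<forall>y\<in>carrier S. R x \<cdot>\<^bsub>S\<^esub> y = x \<cdot>\<^bsub>S\<^esub> L y)}"

definition TrHull :: "'a sgrp \<Rightarrow> (('a \<Rightarrow> 'a) \<times> ('a \<Rightarrow> 'a)) monoid" where
  "TrHull S = \<lparr>carrier = multipliers S,
     mult = (\<lambda>(L', R') (L, R). (compose (carrier S) L' L, compose (carrier S) R R')),
     one = (\<lambda>x\<in>carrier S. x, \<lambda>x\<in>carrier S. x)\<rparr>"

definition canonical_hom :: "'a sgrp \<Rightarrow> 'a \<Rightarrow> ('a \<Rightarrow> 'a) \<times> ('a \<Rightarrow> 'a)" where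
  "canonical_hom S =
     (\<lambda>x\<in>carrier S. (\<lambda>y\<in>carrier S. x \<cdot>\<^bsub>S\<^esub> y, \<lambda>y\<in>carrier S. y \<cdot>\<^bsub>S\<^esub> x))"

text \<open>The argument \<open>f\<close> is meant to be a map from \<open>X\<close> to the carrier of \<open>TrHull T\<close>.\<close>

definition translation_nondegenerate ::
    "'x set \<Rightarrow> 'a sgrp \<Rightarrow> ('x \<Rightarrow> ('a \<Rightarrow> 'a) \<times> ('a \<Rightarrow> 'a)) \<Rightarrow> bool" where
  "translation_nondegenerate X T f \<longleftrightarrow>
     carrier T = {fst (f x) t | x t. x \<in> X \<and> t \<in> carrier T} \<and>
     carrier T = {snd (f x) t | x t. x \<in> X \<and> t \<in> carrier T}"

lemma monoid_hom_imp_sgrp_hom: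
  "h \<in> monoid_hom M N \<Longrightarrow> h \<in> sgrp_hom (forget M) (forget N)"
  by (auto simp: monoid_hom_def sgrp_hom_def forget_def hom_def PiE_def)

lemma sgrp_forget: "monoid M \<Longrightarrow> sgrp (forget M)"
  by (simp add: sgrp_def forget_def monoid.m_assoc monoid.m_closed)

lemma (in sgrp) monoid_TrHull: "monoid (TrHull S)"
proof
  fix p q assume "p \<in> carrier (TrHull S)" "q \<in> carrier (TrHull S)"
  then show "p \<otimes>\<^bsub>TrHull S\<^esub> q \<in> carrier (TrHull S)"
    by (auto simp: TrHull_def multipliers_def left_translations_def right_translations_def
        compose_def PiE_iff)
next
  fix p q r
  assume "p \<in> carrier (TrHull S)" "q \<in> carrier (TrHull S)" "r \<in> carrier (TrHull S)"
  then show "p \<otimes>\<^bsub>TrHull S\<^esub> q \<otimes>\<^bsub>TrHull S\<^esub> r = p \<otimes>\<^bsub>TrHull S\<^esub> (q \<otimes>\<^bsub>TrHull S\<^esub> r)"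
    by (auto simp: TrHull_def multipliers_def left_translations_def right_translations_def
        compose_def PiE_iff fun_eq_iff)
next
  show "\<one>\<^bsub>TrHull S\<^esub> \<in> carrier (TrHull S)"
    by (auto simp: TrHull_def multipliers_def left_translations_def right_translations_def PiE_iff)
next
  fix p assume "p \<in> carrier (TrHull S)"
  then show "\<one>\<^bsub>TrHull S\<^esub> \<otimes>\<^bsub>TrHull S\<^esub> p = p" "p \<otimes>\<^bsub>TrHull S\<^esub> \<one>\<^bsub>TrHull S\<^esub> = p"
    by (auto simp: TrHull_def multipliers_def left_translations_def right_translations_def
        compose_def PiE_iff extensional_def fun_eq_iff) metis+
qed

lemma (in sgrp) canonical_hom_in_sgrp_hom: "canonical_hom S \<in> sgrp_hom S (forget (TrHull S))"
  by (auto simp: canonical_hom_def sgrp_hom_def forget_def TrHull_def multipliers_def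
      left_translations_def right_translations_def compose_def fun_eq_iff sprod_assoc)

end

theory Submission
  imports Defs
begin

text \<open>
  The homomorphism property and the multiplier condition give, for every multiplier
  \<open>(L, R)\<close> of \<open>S\<close>,
  \<open>f\<^sub>R(y)(s) \<cdot> f\<^sub>L(L x)(t) = s \<cdot> f\<^sub>L(y * L x)(t) = s \<cdot> f\<^sub>L(R y * x)(t) = f\<^sub>R(R y)(s) \<cdot> f\<^sub>L(x)(t)\<close>.
  Hence any maps that choose \<open>f\<^sub>L(L x)(t)\<close> for \<open>v = f\<^sub>L(x)(t)\<close> and \<open>f\<^sub>R(R y)(s)\<close> for
  \<open>u = f\<^sub>R(y)(s)\<close> satisfy \<open>R'(u) \<cdot> v = u \<cdot> L'(v)\<close>. In a non-degenerate semigroup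
  this adjointness alone makes \<open>(L', R')\<close> a multiplier, and either component then determines
  the other. Uniqueness follows from \<open>(L, R) \<star> \<MM>\<^sub>S(x) = \<MM>\<^sub>S(L x)\<close>.
\<close>

section \<open>Cancellation in non-degenerate semigroups, and multipliers\<close>

lemma nondegenerate_eqI_left:
  assumes "nondegenerate T" "y \<in> carrier T" "z \<in> carrier T"
    and "\<And>x. x \<in> carrier T \<Longrightarrow> x \<cdot>\<^bsub>T\<^esub> y = x \<cdot>\<^bsub>T\<^esub> z"
  shows "y = z"
  using assms unfolding nondegenerate_def by blast

lemma nondegenerate_eqI_right:
  assumes "nondegenerate T" "y \<in> carrier T" "z \<in> carrier T"
    and "\<And>x. x \<in> carrier T \<Longrightarrow> y \<cdot>\<^bsub>T\<^esub> x = z \<cdot>\<^bsub>T\<^esub> x"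
  shows "y = z"
  using assms unfolding nondegenerate_def by blast

lemma multipliersD:
  assumes "p \<in> multipliers S"
  shows "fst p \<in> carrier S \<rightarrow>\<^sub>E carrier S" "snd p \<in> carrier S \<rightarrow>\<^sub>E carrier S"
    and "\<And>x. x \<in> carrier S \<Longrightarrow> fst p x \<in> carrier S"
    and "\<And>x. x \<in> carrier S \<Longrightarrow> snd p x \<in> carrier S"
    and "\<And>x y. x \<in> carrier S \<Longrightarrow> y \<in> carrier S \<Longrightarrow>
      fst p (x \<cdot>\<^bsub>S\<^esub> y) = fst p x \<cdot>\<^bsub>S\<^esub> y"
    and "\<And>x y. x \<in> carrier S \<Longrightarrow> y \<in> carrier S \<Longrightarrow>
      snd p (x \<cdot>\<^bsub>S\<^esub> y) = x \<cdot>\<^bsub>S\<^esub> snd p y"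
    and "\<And>x y. x \<in> carrier S \<Longrightarrow> y \<in> carrier S \<Longrightarrow>
      snd p x \<cdot>\<^bsub>S\<^esub> y = x \<cdot>\<^bsub>S\<^esub> fst p y"
  using assms
  by (auto simp: multipliers_def left_translations_def right_translations_def)

lemma carrier_TrHull [simp]: "carrier (TrHull S) = multipliers S"
  by (simp add: TrHull_def)

lemma mult_TrHull:
  "p \<otimes>\<^bsub>TrHull S\<^esub> q =
    (compose (carrier S) (fst p) (fst q), compose (carrier S) (snd q) (snd p))"
  by (simp add: TrHull_def case_prod_beta)

lemma one_TrHull: "\<one>\<^bsub>TrHull S\<^esub> = (\<lambda>x\<in>carrier S. x, \<lambda>x\<in>carrier S. x)"
  by (simp add: TrHull_def)

text \<open>Moving a map across the product by \<open>adj\<close> turns both sides of each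
  translation law, multiplied by an arbitrary \<open>u\<close>, into the same product;
  non-degeneracy then cancels \<open>u\<close>.\<close>

lemma (in sgrp) adjoint_imp_multiplier:
  assumes nd: "nondegenerate S"
    and L: "L \<in> carrier S \<rightarrow>\<^sub>E carrier S" and R: "R \<in> carrier S \<rightarrow>\<^sub>E carrier S"
    and adj: "\<And>x y. x \<in> carrier S \<Longrightarrow> y \<in> carrier S \<Longrightarrow> R x \<cdot> y = x \<cdot> L y"
  shows "(L, R) \<in> multipliers S"
proof -
  have LR: "L x \<in> carrier S" "R x \<in> carrier S" if "x \<in> carrier S" for x
    using L R that by auto
  have "L (x \<cdot> y) = L x \<cdot> y" if xy: "x \<in> carrier S" "y \<in> carrier S" for x y
  proof (rule nondegenerate_eqI_left [OF nd])
    fix u assume u: "u \<in> carrier S"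
    \<comment> \<open>The bracketing matters: \<open>adj\<close> first moves \<open>L\<close> off
      \<open>x \<cdot> y\<close>, and its second use acts on \<open>R u \<cdot> x\<close>
      alone.\<close>
    have "u \<cdot> L (x \<cdot> y) = (R u \<cdot> x) \<cdot> y"
      using u xy by (simp add: LR sprod_assoc flip: adj)
    then show "u \<cdot> L (x \<cdot> y) = u \<cdot> (L x \<cdot> y)"
      using u xy by (simp add: LR sprod_assoc adj)
  qed (use xy LR in auto)
  moreover have "R (x \<cdot> y) = x \<cdot> R y" if xy: "x \<in> carrier S" "y \<in> carrier S" for x y
  proof (rule nondegenerate_eqI_right [OF nd])
    fix u assume u: "u \<in> carrier S"
    show "R (x \<cdot> y) \<cdot> u = x \<cdot> R y \<cdot> u"
      using u xy by (simp add: LR sprod_assoc adj)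
  qed (use xy LR in auto)
  ultimately show ?thesis
    using L R adj by (simp add: multipliers_def left_translations_def right_translations_def)
qed

text \<open>Since \<open>snd p u \<cdot> x = u \<cdot> fst p x\<close>, the left component fixes
  every product of \<open>snd p u\<close> with an element on its right, hence \<open>snd p u\<close>
  itself. Later equations between multipliers are therefore checked on left components only.\<close>

lemma multiplier_eqI:
  assumes nd: "nondegenerate T" and p: "p \<in> multipliers T" and q: "q \<in> multipliers T"
    and eq: "\<And>t. t \<in> carrier T \<Longrightarrow> fst p t = fst q t"
  shows "p = q"
proof (rule prod_eqI)
  show "fst p = fst q"
    using multipliersD(1)[OF p] multipliersD(1)[OF q] eq by (rule PiE_ext)
  show "snd p = snd q"
  proof (rule PiE_ext [OF multipliersD(2)[OF p] multipliersD(2)[OF q]])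
    fix u assume u: "u \<in> carrier T"
    show "snd p u = snd q u"
      by (rule nondegenerate_eqI_right [OF nd])
        (use u in \<open>auto simp: multipliersD(4,7)[OF p] multipliersD(4,7)[OF q] eq\<close>)
  qed
qed

lemma canonical_hom_in_multipliers:
  assumes "sgrp S" "x \<in> carrier S"
  shows "canonical_hom S x \<in> multipliers S"
  using sgrp.canonical_hom_in_sgrp_hom [OF assms(1)] assms(2)
  by (auto simp: sgrp_hom_def forget_def)

text \<open>The left components agree by the left translation law, the right ones by the multiplier
  condition \<open>R y \<cdot> x = y \<cdot> L x\<close>. In particular the image of
  \<open>canonical_hom S\<close> is a left ideal of the hull.\<close>

lemma mult_canonical_hom:
  assumes "sgrp S" and p: "p \<in> multipliers S" and x: "x \<in> carrier S"
  shows "p \<otimes>\<^bsub>TrHull S\<^esub> canonical_hom S x = canonical_hom S (fst p x)"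
  using x by (auto simp: mult_TrHull canonical_hom_def compose_def fun_eq_iff
      multipliersD[OF p])

section \<open>Transporting a multiplier of \<open>S\<close> to \<open>T\<close> along
  \<open>f\<close>\<close>

locale hull_map =
  fixes S :: "'a sgrp" and T :: "'b sgrp" and f :: "'a \<Rightarrow> ('b \<Rightarrow> 'b) \<times> ('b \<Rightarrow> 'b)"
  assumes S: "sgrp S" and T: "sgrp T" and nd: "nondegenerate T"
    and f: "f \<in> sgrp_hom S (forget (TrHull T))"
    and tnd: "translation_nondegenerate (carrier S) T f"
begin

lemma f_in: "x \<in> carrier S \<Longrightarrow> f x \<in> multipliers T"
  using f by (auto simp: sgrp_hom_def forget_def)

lemma f_prod: "x \<in> carrier S \<Longrightarrow> y \<in> carrier S \<Longrightarrow> f (x \<cdot>\<^bsub>S\<^esub> y) = f x \<otimes>\<^bsub>TrHull T\<^esub> f y"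
  using f by (auto simp: sgrp_hom_def forget_def)

lemma fst_f_prod:
  "x \<in> carrier S \<Longrightarrow> y \<in> carrier S \<Longrightarrow> t \<in> carrier T \<Longrightarrow>
    fst (f (x \<cdot>\<^bsub>S\<^esub> y)) t = fst (f x) (fst (f y) t)"
  by (simp add: f_prod mult_TrHull compose_def)

lemma fst_f_cases:
  assumes "v \<in> carrier T"
  obtains x t where "x \<in> carrier S" "t \<in> carrier T" "v = fst (f x) t"
  using assms tnd unfolding translation_nondegenerate_def by blast

lemma snd_f_cases:
  assumes "u \<in> carrier T"
  obtains y s where "y \<in> carrier S" "s \<in> carrier T" "u = snd (f y) s"
  using assms tnd unfolding translation_nondegenerate_def by blast

text \<open>Translation non-degeneracy writes every element of \<open>T\<close> as
  \<open>fst (f x) t\<close>, so left components need comparing only there.\<close>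

lemma multiplier_eqI_f:
  assumes "p \<in> multipliers T" "q \<in> multipliers T"
    and "\<And>x t. x \<in> carrier S \<Longrightarrow> t \<in> carrier T \<Longrightarrow> fst p (fst (f x) t) = fst q (fst (f x) t)"
  shows "p = q"
  using assms by (intro multiplier_eqI [OF nd]) (auto elim: fst_f_cases)

text \<open>The pairs \<open>x\<close>, \<open>t\<close> and \<open>y\<close>, \<open>s\<close> vary
  independently, so any representation of an element by left translates is compatible with any
  representation by right translates. This lets \<open>ex_extension\<close> make its choices
  freely.\<close>

lemma adjoint_f:
  assumes p: "p \<in> multipliers S"
    and "x \<in> carrier S" "y \<in> carrier S" "t \<in> carrier T" "s \<in> carrier T"
  shows "snd (f (snd p y)) s \<cdot>\<^bsub>T\<^esub> fst (f x) t = snd (f y) s \<cdot>\<^bsub>T\<^esub> fst (f (fst p x)) t"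
  using assms
  by (simp add: f_in multipliersD(3,4)[OF p] multipliersD(3,7)[OF f_in]
      multipliersD(7)[OF p] flip: fst_f_prod)

text \<open>The required equation prescribes \<open>fst q\<close> on all of \<open>T\<close>, but an
  element may have several representations \<open>fst (f x) t\<close>. One is chosen for each
  element, and independence of the choice is derived afterwards from adjointness.\<close>

lemma ex_extension:
  assumes p: "p \<in> multipliers S"
  shows "\<exists>q\<in>multipliers T. \<forall>x\<in>carrier S. \<forall>t\<in>carrier T.
    fst q (fst (f x) t) = fst (f (fst p x)) t"
proof -
  interpret T: sgrp T by (rule T)
  have "\<forall>v\<in>carrier T. \<exists>w. \<exists>x\<in>carrier S. \<exists>t\<in>carrier T. v = fst (f x) t \<and> w = fst (f (fst p x)) t"
    by (metis fst_f_cases)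
  then obtain L where L: "\<And>v. v \<in> carrier T \<Longrightarrow>
      \<exists>x\<in>carrier S. \<exists>t\<in>carrier T. v = fst (f x) t \<and> L v = fst (f (fst p x)) t"
    by (metis bchoice)
  have "\<forall>u\<in>carrier T. \<exists>w. \<exists>y\<in>carrier S. \<exists>s\<in>carrier T. u = snd (f y) s \<and> w = snd (f (snd p y)) s"
    by (metis snd_f_cases)
  then obtain R where R: "\<And>u. u \<in> carrier T \<Longrightarrow>
      \<exists>y\<in>carrier S. \<exists>s\<in>carrier T. u = snd (f y) s \<and> R u = snd (f (snd p y)) s"
    by (metis bchoice)
  have in_T: "L v \<in> carrier T" "R v \<in> carrier T" if "v \<in> carrier T" for v
    using L [OF that] R [OF that] multipliersD(3,4)[OF p] multipliersD(3,4)[OF f_in] by metis+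
  have adj: "R u \<cdot>\<^bsub>T\<^esub> v = u \<cdot>\<^bsub>T\<^esub> L v" if "u \<in> carrier T" "v \<in> carrier T" for u v
    using L [OF that(2)] R [OF that(1)] adjoint_f [OF p] by metis
  have "(restrict L (carrier T), restrict R (carrier T)) \<in> multipliers T"
    by (rule T.adjoint_imp_multiplier [OF nd]) (simp_all add: in_T adj)
  \<comment> \<open>\<open>L\<close> may have been defined through a representation other than
    \<open>x\<close>, \<open>t\<close>. Multiplying by \<open>u\<close> on the left replaces
    \<open>L\<close> by \<open>R u\<close>, and \<open>adjoint_f\<close> evaluates the result for
    the given \<open>x\<close>, \<open>t\<close>.\<close>
  moreover have "L (fst (f x) t) = fst (f (fst p x)) t"
    if xt: "x \<in> carrier S" "t \<in> carrier T" for x t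
  proof (rule nondegenerate_eqI_left [OF nd])
    fix u assume u: "u \<in> carrier T"
    then obtain y s where ys: "y \<in> carrier S" "s \<in> carrier T"
        "u = snd (f y) s" "R u = snd (f (snd p y)) s"
      using R by blast
    then have "R u \<cdot>\<^bsub>T\<^esub> fst (f x) t = u \<cdot>\<^bsub>T\<^esub> fst (f (fst p x)) t"
      using adjoint_f [OF p] xt by simp
    then show "u \<cdot>\<^bsub>T\<^esub> L (fst (f x) t) = u \<cdot>\<^bsub>T\<^esub> fst (f (fst p x)) t"
      using u xt by (simp add: adj multipliersD(3)[OF f_in])
  qed (use xt in \<open>simp_all add: in_T multipliersD(3)[OF f_in] multipliersD(3)[OF p]\<close>)
  ultimately show ?thesis
    by (intro bexI) (auto simp: multipliersD(3)[OF f_in])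
qed

section \<open>Existence and uniqueness of the monoid homomorphism\<close>

lemma ex_hom:
  "\<exists>g. g \<in> monoid_hom (TrHull S) (TrHull T) \<and> compose (carrier S) g (canonical_hom S) = f"
proof -
  interpret MS: monoid "TrHull S" by (rule sgrp.monoid_TrHull [OF S])
  interpret MT: monoid "TrHull T" by (rule sgrp.monoid_TrHull [OF T])
  \<comment> \<open>\<open>g\<close> picks an extension for each multiplier; \<open>g_f\<close>
    gives its values on all \<open>fst (f x) t\<close>, so \<open>multiplier_eqI_f\<close> reduces
    every law for \<open>g\<close> to a computation with \<open>g_f\<close>.\<close>
  obtain g where g_in: "\<And>p. p \<in> multipliers S \<Longrightarrow> g p \<in> multipliers T"
    and g_f: "\<And>p x t. p \<in> multipliers S \<Longrightarrow> x \<in> carrier S \<Longrightarrow> t \<in> carrier T \<Longrightarrow>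
      fst (g p) (fst (f x) t) = fst (f (fst p x)) t"
    using ex_extension by metis
  have f_T: "fst (f x) t \<in> carrier T" if "x \<in> carrier S" "t \<in> carrier T" for x t
    using multipliersD(3)[OF f_in] that by blast
  have mult_S: "p \<otimes>\<^bsub>TrHull S\<^esub> q \<in> multipliers S"
    if "p \<in> multipliers S" "q \<in> multipliers S" for p q
    using MS.m_closed that by simp
  have mult_T: "p \<otimes>\<^bsub>TrHull T\<^esub> q \<in> multipliers T"
    if "p \<in> multipliers T" "q \<in> multipliers T" for p q
    using MT.m_closed that by simp
  have g_mult: "g (p \<otimes>\<^bsub>TrHull S\<^esub> q) = g p \<otimes>\<^bsub>TrHull T\<^esub> g q"
    if pq: "p \<in> multipliers S" "q \<in> multipliers S" for p q
  proof (rule multiplier_eqI_f)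
    fix x t assume xt: "x \<in> carrier S" "t \<in> carrier T"
    have "fst (g (p \<otimes>\<^bsub>TrHull S\<^esub> q)) (fst (f x) t) = fst (f (fst p (fst q x))) t"
      \<comment> \<open>\<open>g_f\<close> has to act while the product is still intact, since
        \<open>mult_S\<close> recognises it as a multiplier only in that form.\<close>
      using pq xt mult_S by (simp add: g_f) (simp add: mult_TrHull compose_def)
    then show "fst (g (p \<otimes>\<^bsub>TrHull S\<^esub> q)) (fst (f x) t) =
        fst (g p \<otimes>\<^bsub>TrHull T\<^esub> g q) (fst (f x) t)"
      using pq xt by (simp add: mult_TrHull compose_def f_T g_f multipliersD(3))
  qed (simp_all add: g_in mult_S mult_T pq)
  have g_one: "g \<one>\<^bsub>TrHull S\<^esub> = \<one>\<^bsub>TrHull T\<^esub>"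
  proof (rule multiplier_eqI_f)
    fix x t assume xt: "x \<in> carrier S" "t \<in> carrier T"
    have "fst (g \<one>\<^bsub>TrHull S\<^esub>) (fst (f x) t) = fst (f (fst \<one>\<^bsub>TrHull S\<^esub> x)) t"
      using xt MS.one_closed by (simp add: g_f)
    then show "fst (g \<one>\<^bsub>TrHull S\<^esub>) (fst (f x) t) = fst \<one>\<^bsub>TrHull T\<^esub> (fst (f x) t)"
      using xt by (simp add: one_TrHull f_T)
  qed (use MS.one_closed MT.one_closed g_in in auto)
  have g_canonical: "g (canonical_hom S z) = f z" if z: "z \<in> carrier S" for z
  proof (rule multiplier_eqI_f)
    fix x t assume xt: "x \<in> carrier S" "t \<in> carrier T"
    have "fst (g (canonical_hom S z)) (fst (f x) t) = fst (f (fst (canonical_hom S z) x)) t"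
      using xt z by (simp add: g_f canonical_hom_in_multipliers [OF S])
    also have "\<dots> = fst (f z) (fst (f x) t)"
      using xt z by (simp add: canonical_hom_def fst_f_prod)
    finally show "fst (g (canonical_hom S z)) (fst (f x) t) = fst (f z) (fst (f x) t)" .
  qed (use z in \<open>simp_all add: g_in f_in canonical_hom_in_multipliers [OF S]\<close>)
  \<comment> \<open>The restriction supplies the extensionality that \<open>monoid_hom\<close>
    demands.\<close>
  have "restrict g (multipliers S) \<in> monoid_hom (TrHull S) (TrHull T)"
    using g_in g_mult g_one mult_S MS.one_closed by (simp add: monoid_hom_def hom_def)
  moreover have "compose (carrier S) (restrict g (multipliers S)) (canonical_hom S) = f"
  proof (rule extensionalityI)
    show "f \<in> extensional (carrier S)"
      using f by (simp add: sgrp_hom_def PiE_def)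
  qed (auto simp: compose_def g_canonical canonical_hom_in_multipliers [OF S])
  ultimately show ?thesis by blast
qed

lemma hom_unique:
  assumes g: "g \<in> monoid_hom (TrHull S) (TrHull T)"
      "compose (carrier S) g (canonical_hom S) = f"
    and h: "h \<in> monoid_hom (TrHull S) (TrHull T)"
      "compose (carrier S) h (canonical_hom S) = f"
  shows "g = h"
proof -
  have k_in: "k p \<in> multipliers T"
    if "k \<in> monoid_hom (TrHull S) (TrHull T)" "p \<in> multipliers S" for k p
    using that by (auto simp: monoid_hom_def hom_def)
  \<comment> \<open>Applying \<open>k\<close> to \<open>mult_canonical_hom\<close> yields
    \<open>k p \<otimes> f x = f (fst p x)\<close> in the hull of \<open>T\<close>; its left
    component forces on \<open>k\<close> the formula used to construct the extension.\<close>
  have k_f: "fst (k p) (fst (f x) t) = fst (f (fst p x)) t"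
    if k: "k \<in> monoid_hom (TrHull S) (TrHull T)" "compose (carrier S) k (canonical_hom S) = f"
      and p: "p \<in> multipliers S" and x: "x \<in> carrier S" and t: "t \<in> carrier T" for k p x t
  proof -
    have c: "k (canonical_hom S z) = f z" if "z \<in> carrier S" for z
      using k(2) that by (auto simp: compose_def)
    have "k p \<otimes>\<^bsub>TrHull T\<^esub> k (canonical_hom S x) = k (p \<otimes>\<^bsub>TrHull S\<^esub> canonical_hom S x)"
      using k(1) p canonical_hom_in_multipliers [OF S x] by (simp add: monoid_hom_def hom_def)
    then have "k p \<otimes>\<^bsub>TrHull T\<^esub> f x = f (fst p x)"
      using x multipliersD(3)[OF p x] by (simp add: mult_canonical_hom [OF S p] c)
    then have "fst (k p \<otimes>\<^bsub>TrHull T\<^esub> f x) t = fst (f (fst p x)) t"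
      by simp
    then show ?thesis
      using t by (simp add: mult_TrHull compose_def)
  qed
  show ?thesis
  proof (rule extensionalityI)
    show "g \<in> extensional (multipliers S)" "h \<in> extensional (multipliers S)"
      using g(1) h(1) by (auto simp: monoid_hom_def)
    show "g p = h p" if "p \<in> multipliers S" for p
      by (rule multiplier_eqI_f) (use that in \<open>simp_all add: k_in g(1) h(1) k_f [OF g] k_f [OF h]\<close>)
  qed
qed

end

text \<open>The unit of \<open>TrHull S\<close> is sent to the pair of identity maps, so each
  \<open>t\<close> is the translate of itself by the image of the unit, on either side.\<close>

lemma translation_nondegenerate_monoid_hom:
  assumes "sgrp S" and g: "g \<in> monoid_hom (TrHull S) (TrHull T)"
  shows "translation_nondegenerate (carrier (TrHull S)) T g"
proof -
  have one: "\<one>\<^bsub>TrHull S\<^esub> \<in> multipliers S"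
    using monoid.one_closed [OF sgrp.monoid_TrHull [OF assms(1)]] by simp
  have g_in: "g p \<in> multipliers T" if "p \<in> multipliers S" for p
    using g that by (auto simp: monoid_hom_def hom_def)
  have "fst (g \<one>\<^bsub>TrHull S\<^esub>) t = t" "snd (g \<one>\<^bsub>TrHull S\<^esub>) t = t" if "t \<in> carrier T" for t
    using g that by (simp_all add: monoid_hom_def one_TrHull [of T])
  then have "\<exists>p t. v = fst (g p) t \<and> p \<in> multipliers S \<and> t \<in> carrier T"
    "\<exists>p t. v = snd (g p) t \<and> p \<in> multipliers S \<and> t \<in> carrier T" if "v \<in> carrier T" for v
    using one that by metis+
  then show ?thesis
    by (auto simp: translation_nondegenerate_def multipliersD(3,4)[OF g_in])
qed

theorem theorem56:
  fixes S :: "'a sgrp" and T :: "'b sgrp"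
    and f :: "'a \<Rightarrow> ('b \<Rightarrow> 'b) \<times> ('b \<Rightarrow> 'b)"
  assumes "sgrp S" and "sgrp T" and "nondegenerate T"
    and "f \<in> sgrp_hom S (forget (TrHull T))"
    and "translation_nondegenerate (carrier S) T f"
  shows "(\<exists>!g. g \<in> monoid_hom (TrHull S) (TrHull T) \<and>
             compose (carrier S) g (canonical_hom S) = f) \<and>
         (\<forall>g. g \<in> monoid_hom (TrHull S) (TrHull T) \<and>
             compose (carrier S) g (canonical_hom S) = f \<longrightarrow>
             translation_nondegenerate (carrier (TrHull S)) T g)"
proof -
  interpret hull_map S T f
    using assms by (rule hull_map.intro)
  show ?thesis
    using ex_hom hom_unique translation_nondegenerate_monoid_hom [OF S] by blast
qed

end
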